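(* For $X\neq Y\subseteq\mathbb{N}$ we have $\mathbf{HSP}(\mathfrak{B}_X)\neq\mathbf{HSP}(\mathfrak{B}_Y)$. In particular, there are continuum many contractive varieties of Boolean frames lacking the congruence extension property.
   Context: A Boolean frame is an algebra $\langle A,\sqcap,-,0,f\rangle$ with $\langle A,\sqcap,-,0\rangle$ a Boolean algebra and $f:A\to A$ an arbitrary unary operation; it is contractive if $f(x)\le x$ for all $x$. An algebra has the congruence extension property (CEP) if for every subalgebra $B$ and every congruence $\Theta$ of $B$ there is a congruence $\Psi$ of the algebra with $\Psi\cap(B\times B)=\Theta$; a variety lacks CEP if some member lacks it. $\mathbf{HSP}(\mathfrak{B})$ is the variety generated by $\mathfrak{B}$. Let $E=\{2n:n\in\mathbb{N}\}$ and $2E=\{2n:n\in E\}$. For $X\subseteq\mathbb{N}$, $\mathfrak{B}_X=\langle\mathcal{P}(\mathbb{N}),h\rangle$ is the powerset Boolean algebra of $\mathbb{N}$ with $h$ defined for $S\subseteq\mathbb{N}$ by: $h(S)=\mathbb{N}\setminus\{0,\dots,n\}$ if $S=\mathbb{N}\setminus\{0,\dots,n-1\}$ for some $n\in\mathbb{N}$ (so $h(\mathbb{N})=\mathbb{N}\setminus\{0\}$); $h(S)=\emptyset$ if $S=\mathbb{N}\setminus 2E$; $h(S)=\emptyset$ if $S=\{0,\dots,n\}$ for some $n\in X$; and $h(S)=S$ otherwise. *)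

theory Defs
  imports Complex_Main "HOL-Library.FuncSet" "HOL-Library.Equipollence"
begin

record 'a bframe =
  carr :: "'a set"
  meet :: "'a \<Rightarrow> 'a \<Rightarrow> 'a"
  neg  :: "'a \<Rightarrow> 'a"
  zero :: "'a"
  fop  :: "'a \<Rightarrow> 'a"

definition join :: "'a bframe \<Rightarrow> 'a \<Rightarrow> 'a \<Rightarrow> 'a" where
  "join A x y = neg A (meet A (neg A x) (neg A y))"

definition one :: "'a bframe \<Rightarrow> 'a" where
  "one A = neg A (zero A)"

definition le :: "'a bframe \<Rightarrow> 'a \<Rightarrow> 'a \<Rightarrow> bool" where
  "le A x y \<longleftrightarrow> meet A x y = x"

definition closed_under_ops :: "'a bframe \<Rightarrow> 'a set \<Rightarrow> bool" where
  "closed_under_ops A S \<longleftrightarrow>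
     zero A \<in> S \<and>
     (\<forall>x\<in>S. \<forall>y\<in>S. meet A x y \<in> S) \<and>
     (\<forall>x\<in>S. neg A x \<in> S) \<and>
     (\<forall>x\<in>S. fop A x \<in> S)"

text \<open>Boolean algebra axioms (a superset of Huntington's postulates) in the signature
  meet, complement, zero, with join and one derived. One-element algebras are
  allowed, and the unary operation is arbitrary.\<close>

definition boolean_frame :: "'a bframe \<Rightarrow> bool" where
  "boolean_frame A \<longleftrightarrow>
     closed_under_ops A (carr A) \<and>
     (\<forall>x\<in>carr A. \<forall>y\<in>carr A. meet A x y = meet A y x) \<and>
     (\<forall>x\<in>carr A. \<forall>y\<in>carr A. join A x y = join A y x) \<and>
     (\<forall>x\<in>carr A. \<forall>y\<in>carr A. \<forall>z\<in>carr A.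
        meet A (meet A x y) z = meet A x (meet A y z)) \<and>
     (\<forall>x\<in>carr A. \<forall>y\<in>carr A. \<forall>z\<in>carr A.
        join A (join A x y) z = join A x (join A y z)) \<and>
     (\<forall>x\<in>carr A. \<forall>y\<in>carr A. \<forall>z\<in>carr A.
        meet A x (join A y z) = join A (meet A x y) (meet A x z)) \<and>
     (\<forall>x\<in>carr A. \<forall>y\<in>carr A. \<forall>z\<in>carr A.
        join A x (meet A y z) = meet A (join A x y) (join A x z)) \<and>
     (\<forall>x\<in>carr A. meet A x (one A) = x) \<and>
     (\<forall>x\<in>carr A. join A x (zero A) = x) \<and>
     (\<forall>x\<in>carr A. meet A x (neg A x) = zero A) \<and>
     (\<forall>x\<in>carr A. join A x (neg A x) = one A)"

definition contractive :: "'a bframe \<Rightarrow> bool" where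
  "contractive A \<longleftrightarrow> (\<forall>x\<in>carr A. le A (fop A x) x)"

definition subuniverse :: "'a set \<Rightarrow> 'a bframe \<Rightarrow> bool" where
  "subuniverse S A \<longleftrightarrow> S \<subseteq> carr A \<and> closed_under_ops A S"

definition hom :: "'a bframe \<Rightarrow> 'b bframe \<Rightarrow> ('a \<Rightarrow> 'b) set" where
  "hom A B = {g. g ` carr A \<subseteq> carr B \<and>
     g (zero A) = zero B \<and>
     (\<forall>x\<in>carr A. \<forall>y\<in>carr A. g (meet A x y) = meet B (g x) (g y)) \<and>
     (\<forall>x\<in>carr A. g (neg A x) = neg B (g x)) \<and>
     (\<forall>x\<in>carr A. g (fop A x) = fop B (g x))}"

definition product :: "'i set \<Rightarrow> ('i \<Rightarrow> 'a bframe) \<Rightarrow> ('i \<Rightarrow> 'a) bframe" where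
  "product I F =
     \<lparr> carr = (\<Pi>\<^sub>E i\<in>I. carr (F i)),
       meet = (\<lambda>x y. \<lambda>i\<in>I. meet (F i) (x i) (y i)),
       neg  = (\<lambda>x. \<lambda>i\<in>I. neg (F i) (x i)),
       zero = (\<lambda>i\<in>I. zero (F i)),
       fop  = (\<lambda>x. \<lambda>i\<in>I. fop (F i) (x i)) \<rparr>"

definition congruence :: "'a bframe \<Rightarrow> ('a \<times> 'a) set \<Rightarrow> bool" where
  "congruence A \<Theta> \<longleftrightarrow>
     equiv (carr A) \<Theta> \<and>
     (\<forall>x x' y y'. (x, x') \<in> \<Theta> \<longrightarrow> (y, y') \<in> \<Theta> \<longrightarrow> (meet A x y, meet A x' y') \<in> \<Theta>) \<and>
     (\<forall>x x'. (x, x') \<in> \<Theta> \<longrightarrow> (neg A x, neg A x') \<in> \<Theta>) \<and>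
     (\<forall>x x'. (x, x') \<in> \<Theta> \<longrightarrow> (fop A x, fop A x') \<in> \<Theta>)"

definition CEP :: "'a bframe \<Rightarrow> bool" where
  "CEP A \<longleftrightarrow>
     (\<forall>B \<Theta>. subuniverse B A \<longrightarrow> congruence (A\<lparr>carr := B\<rparr>) \<Theta> \<longrightarrow>
        (\<exists>\<Psi>. congruence A \<Psi> \<and> \<Psi> \<inter> (B \<times> B) = \<Theta>))"

definition Hcl :: "'a bframe set \<Rightarrow> 'b bframe set" where
  "Hcl K = {A. \<exists>B\<in>K. \<exists>g\<in>hom B A. g ` carr B = carr A}"

definition Scl :: "'a bframe set \<Rightarrow> 'a bframe set" where
  "Scl K = {A\<lparr>carr := B\<rparr> | A B. A \<in> K \<and> subuniverse B A}"

definition Pcl :: "'a bframe set \<Rightarrow> ('i \<Rightarrow> 'a) bframe set" where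
  "Pcl K = {product I F | (I :: 'i set) F. \<forall>i\<in>I. F i \<in> K}"

text \<open>HOL has no proper classes of algebras, so \<open>HSP K\<close> is the part of the class that
  consists of algebras with carrier in a given type \<open>'u\<close>, the universe; its members need not
  live in the type of the generating algebras. Products are indexed by subsets of \<open>'u\<close>. For
  infinite \<open>'u\<close> this loses nothing: an algebra \<open>A\<close> with carrier in \<open>'u\<close> that is a
  homomorphic image of a subalgebra of any product of members of \<open>K\<close> is an image of the
  \<open>K\<close>-free algebra with generating set \<open>A\<close>, and that algebra embeds into a product with one
  factor for each pair of terms over \<open>A\<close> that some member of \<open>K\<close> separates.\<close>

definition HSP :: "'a bframe set \<Rightarrow> 'u bframe set" where
  "HSP K = Hcl (Scl (Pcl K :: ('u \<Rightarrow> 'a) bframe set))"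

text \<open>Varieties of Boolean frames, relative to the universe \<open>'u\<close>. Closure is required for the
  composite operator because a product of members need not itself fit into \<open>'u\<close>, even if
  subalgebras and quotients of it do. A variety is determined by its countable members, so for
  infinite \<open>'u\<close> restriction to \<open>'u\<close> is a bijection from varieties onto these sets.\<close>

definition variety :: "'u bframe set \<Rightarrow> bool" where
  "variety V \<longleftrightarrow> (\<forall>A\<in>V. boolean_frame A) \<and> HSP V \<subseteq> V"

definition contractive_variety :: "'u bframe set \<Rightarrow> bool" where
  "contractive_variety V \<longleftrightarrow> variety V \<and> (\<forall>A\<in>V. contractive A)"

definition lacks_CEP :: "'u bframe set \<Rightarrow> bool" where
  "lacks_CEP V \<longleftrightarrow> (\<exists>A\<in>V. \<not> CEP A)"

definition E :: "nat set" where
  "E = {2 * n | n. True}"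

definition twoE :: "nat set" where
  "twoE = {2 * n | n. n \<in> E}"

definition h :: "nat set \<Rightarrow> nat set \<Rightarrow> nat set" where
  "h X S =
     (if \<exists>n. S = UNIV - {..<n} then UNIV - {..(THE n. S = UNIV - {..<n})}
      else if S = UNIV - twoE then {}
      else if \<exists>n\<in>X. S = {..n} then {}
      else S)"

definition \<BB> :: "nat set \<Rightarrow> nat set bframe" where
  "\<BB> X = \<lparr> carr = UNIV, meet = (\<inter>), neg = uminus, zero = {}, fop = h X \<rparr>"

lemma h_final_segment: "h X (UNIV - {..<n}) = UNIV - {..n}"
proof -
  have "(THE m. UNIV - {..<n} = UNIV - {..<m}) = n"
  proof (rule the_equality)
    fix m assume "UNIV - {..<n} = UNIV - {..<m}"
    then have "{..<n} = {..<m}" by (metis Compl_eq_Diff_UNIV double_complement)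
    then show "m = n" by simp
  qed (rule refl)
  moreover have "\<exists>m. UNIV - {..<n} = UNIV - {..<m}" by (rule exI, rule refl)
  ultimately show ?thesis unfolding h_def by (simp only: if_True)
qed

lemma h_compl_twoE: "h X (UNIV - twoE) = {}"
proof -
  have mem: "2 * (2 * m) \<in> twoE" for m
    unfolding twoE_def E_def by blast
  have "UNIV - twoE \<noteq> UNIV - {..<n}" for n
  proof
    assume "UNIV - twoE = UNIV - {..<n}"
    then have "twoE = {..<n}" by (metis Compl_eq_Diff_UNIV double_complement)
    with mem[of n] have "2 * (2 * n) \<in> {..<n}" by (simp only:)
    then show False by simp
  qed
  then show ?thesis by (simp add: h_def)
qed

lemma boolean_frame_\<BB>: "boolean_frame (\<BB> X)"
  unfolding boolean_frame_def closed_under_ops_def join_def one_def \<BB>_def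
  by (intro conjI ballI; simp only: bframe.simps; blast)

lemma contractive_\<BB>: "contractive (\<BB> X)"
proof -
  have "h X S \<subseteq> S" for S
  proof (cases "\<exists>n. S = UNIV - {..<n}")
    case True
    then obtain n where S: "S = UNIV - {..<n}" by blast
    have "UNIV - {..n} \<subseteq> UNIV - {..<n}" by fastforce
    then show ?thesis by (simp only: S h_final_segment)
  next
    case False
    then have "h X S = {} \<or> h X S = S" by (simp only: h_def if_False split: if_split) blast
    then show ?thesis by blast
  qed
  then show ?thesis
    by (simp add: contractive_def le_def \<BB>_def Int_absorb2)
qed

end

theory Submission
  imports Defs "HOL-Analysis.Abstract_Topology_2"
begin

text \<open>
  Birkhoff's theorem identifies \<open>HSP K\<close> with the models of the equations that hold in \<open>K\<close>.
  The frames \<open>\<BB> X\<close> are then told apart by constant terms: \<open>f\<^bsup>n+1\<^esup>(1)\<close> is \<open>\<nat> - {0..n}\<close>, so the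
  equation \<open>f(-f\<^bsup>n+1\<^esup>(1)) = 0\<close> holds in \<open>\<BB> X\<close> iff \<open>n \<in> X\<close>. Since there are only countably many
  terms, there are at most continuum many varieties.

  For the failure of the congruence extension property, take the subalgebra of those sets that
  agree up to finitely many elements with one of \<open>\<emptyset>, E, \<nat> - E, \<nat>\<close>, and on it the congruence
  \<open>finite symmetric difference\<close>. A congruence of \<open>\<BB> X\<close> that identifies \<open>\<nat>\<close> with \<open>\<nat> - {0}\<close> also
  identifies \<open>\<nat> - 2E\<close> with \<open>(\<nat> - 2E) \<union> {0}\<close>; applying \<open>h\<close>, it identifies \<open>\<emptyset>\<close> with
  \<open>(\<nat> - 2E) \<union> {0}\<close>, and hence with the infinite set \<open>\<nat> - E\<close>.
\<close>

section \<open>Terms and equations\<close>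

datatype 'v bterm =
  Var 'v | Bot | Meet "'v bterm" "'v bterm" | Neg "'v bterm" | Fop "'v bterm"

primrec eval :: "'a bframe \<Rightarrow> ('v \<Rightarrow> 'a) \<Rightarrow> 'v bterm \<Rightarrow> 'a" where
  "eval A v (Var x) = v x"
| "eval A v Bot = zero A"
| "eval A v (Meet s t) = meet A (eval A v s) (eval A v t)"
| "eval A v (Neg s) = neg A (eval A v s)"
| "eval A v (Fop s) = fop A (eval A v s)"

definition sat :: "'a bframe \<Rightarrow> 'v bterm \<Rightarrow> 'v bterm \<Rightarrow> bool" where
  "sat A s t \<longleftrightarrow> (\<forall>v. range v \<subseteq> carr A \<longrightarrow> eval A v s = eval A v t)"

definition theory_of :: "'a bframe set \<Rightarrow> (nat bterm \<times> nat bterm) set" where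
  "theory_of K = {(s, t). \<forall>A\<in>K. sat A s t}"

lemma eval_in:
  assumes "closed_under_ops A S" "range v \<subseteq> S"
  shows "eval A v t \<in> S"
  using assms by (induction t) (auto simp: closed_under_ops_def)

lemma eval_cong: "(\<And>x. x \<in> set_bterm t \<Longrightarrow> v x = w x) \<Longrightarrow> eval A v t = eval A w t"
  by (induction t) auto

lemma eval_map: "eval A v (map_bterm r t) = eval A (v \<circ> r) t"
  by (induction t) auto

lemma eval_carr_update: "eval (A\<lparr>carr := B\<rparr>) v t = eval A v t"
  by (induction t) auto

lemma eval_hom:
  assumes "g \<in> hom A B" "closed_under_ops A (carr A)" "range v \<subseteq> carr A"
  shows "g (eval A v t) = eval B (g \<circ> v) t"
  using assms(1) by (induction t) (auto simp: hom_def eval_in[OF assms(2,3)])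

lemma eval_product:
  "i \<in> I \<Longrightarrow> eval (product I F) v t i = eval (F i) (\<lambda>x. v x i) t"
  by (induction t) (auto simp: product_def)

lemma finite_set_bterm: "finite (set_bterm t)"
  by (induction t) auto

text \<open>Terms are coded by recursion: an infinite type admits an injective pairing
  \<open>q\<close>, and five distinct elements \<open>c 0\<close>, ..., \<open>c 4\<close> tag the
  constructors.\<close>

lemma infinite_inj_bterm:
  assumes "infinite (UNIV :: 'u set)"
  shows "\<exists>e :: 'u bterm \<Rightarrow> 'u. inj e"
proof -
  obtain q :: "'u \<times> 'u \<Rightarrow> 'u" where q: "inj q"
    using card_of_Times_same_infinite[OF assms]
    by (metis UNIV_Times_UNIV bij_betw_def card_of_ordIso)
  obtain c :: "nat \<Rightarrow> 'u" where c: "inj c"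
    using infinite_countable_subset[OF assms] by auto
  define e :: "'u bterm \<Rightarrow> 'u" where
    "e = rec_bterm (\<lambda>x. q (c 0, x)) (q (c 1, undefined))
       (\<lambda>_ _ a b. q (c 2, q (a, b))) (\<lambda>_ a. q (c 3, a)) (\<lambda>_ a. q (c 4, a))"
  have e_simps: "e (Var x) = q (c 0, x)" "e Bot = q (c 1, undefined)"
    "e (Meet s t) = q (c 2, q (e s, e t))" "e (Neg s) = q (c 3, e s)" "e (Fop s) = q (c 4, e s)"
    for x s t by (simp_all add: e_def)
  have "e s = e t \<Longrightarrow> s = t" for s t
  proof (induction s arbitrary: t)
    case (Var x) then show ?case by (cases t) (auto simp: e_simps inj_eq[OF q] inj_eq[OF c])
  next
    case Bot then show ?case by (cases t) (auto simp: e_simps inj_eq[OF q] inj_eq[OF c])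
  next
    case (Meet s1 s2) then show ?case
      by (cases t) (auto simp: e_simps inj_eq[OF q] inj_eq[OF c])
  next
    case (Neg s) then show ?case by (cases t) (auto simp: e_simps inj_eq[OF q] inj_eq[OF c])
  next
    case (Fop s) then show ?case by (cases t) (auto simp: e_simps inj_eq[OF q] inj_eq[OF c])
  qed
  then have "inj e" by (rule injI)
  then show ?thesis by blast
qed

text \<open>Products inside \<open>HSP\<close> are indexed by elements of \<open>'u\<close>, so
  pairs of terms need codes there. \<open>Meet s t\<close> already packs a pair into one
  term.\<close>

lemma infinite_inj_bterm_pairs:
  assumes "infinite (UNIV :: 'u set)"
  shows "\<exists>e :: 'u bterm \<times> 'u bterm \<Rightarrow> 'u. inj e"
proof -
  obtain e :: "'u bterm \<Rightarrow> 'u" where "inj e"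
    using infinite_inj_bterm[OF assms] ..
  then have "inj (\<lambda>(s, t). e (Meet s t))"
    by (auto intro!: injI dest: injD)
  then show ?thesis by blast
qed

section \<open>Birkhoff's theorem\<close>

lemma closed_product:
  assumes "\<forall>i\<in>I. closed_under_ops (F i) (carr (F i))"
  shows "closed_under_ops (product I F) (carr (product I F))"
  using assms unfolding closed_under_ops_def product_def by (auto simp: PiE_iff)

lemma closed_hom_image:
  assumes "g \<in> hom B A" "g ` carr B = carr A" "closed_under_ops B (carr B)"
  shows "closed_under_ops A (carr A)"
  using assms(1,3) unfolding assms(2)[symmetric] closed_under_ops_def hom_def
  by (auto simp: image_iff) metis+

lemma HSP_E:
  fixes A :: "'u bframe" and K :: "'a bframe set"
  assumes "A \<in> HSP K"
  obtains I :: "'u set" and F S g where "\<forall>i\<in>I. F i \<in> K" "subuniverse S (product I F)"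
    "g \<in> hom ((product I F)\<lparr>carr := S\<rparr>) A" "g ` S = carr A"
  using assms unfolding HSP_def Hcl_def Scl_def Pcl_def by auto

lemma closed_HSP:
  assumes "A \<in> HSP K"
  shows "closed_under_ops A (carr A)"
  using assms
proof (rule HSP_E)
  fix I F S g
  assume "subuniverse S (product I F)" "g \<in> hom ((product I F)\<lparr>carr := S\<rparr>) A" "g ` S = carr A"
  then show ?thesis
    using closed_hom_image[of g "(product I F)\<lparr>carr := S\<rparr>" A]
    by (simp add: subuniverse_def closed_under_ops_def)
qed

text \<open>A valuation in \<open>A\<close> lifts along the surjection \<open>g\<close> to a
  valuation in \<open>B\<close>, and \<open>g\<close> commutes with evaluation.\<close>

lemma sat_hom_image:
  assumes g: "g \<in> hom B A" "g ` carr B = carr A" and cl: "closed_under_ops B (carr B)"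
    and sat: "sat B s t"
  shows "sat A s t"
  unfolding sat_def
proof (intro allI impI)
  fix v :: "'c \<Rightarrow> 'b" assume v: "range v \<subseteq> carr A"
  then have "\<forall>x. \<exists>b\<in>carr B. g b = v x" using g(2) by (metis imageE rangeI subsetD)
  then obtain w where w: "\<And>x. w x \<in> carr B" "\<And>x. g (w x) = v x" by metis
  then have "range w \<subseteq> carr B" "g \<circ> w = v" by auto
  then show "eval A v s = eval A v t"
    using eval_hom[OF g(1) cl, of w] sat unfolding sat_def by metis
qed

lemma sat_product:
  assumes "\<forall>i\<in>I. sat (F i) s t" "\<forall>i\<in>I. closed_under_ops (F i) (carr (F i))"
  shows "sat (product I F) s t"
  unfolding sat_def
proof (intro allI impI)
  fix v :: "'c \<Rightarrow> 'a \<Rightarrow> 'b" assume v: "range v \<subseteq> carr (product I F)"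
  \<comment> \<open>Both values are extensional functions on \<open>I\<close>, so it suffices to
    compare them at the indices in \<open>I\<close>.\<close>
  have in_carr: "eval (product I F) v u \<in> (\<Pi>\<^sub>E i\<in>I. carr (F i))" for u
    using eval_in[OF closed_product[OF assms(2)] v] by (simp add: product_def)
  have "eval (product I F) v s i = eval (product I F) v t i" if "i \<in> I" for i
  proof -
    have "range (\<lambda>x. v x i) \<subseteq> carr (F i)"
      using v that by (auto simp: product_def image_subset_iff PiE_iff)
    then show ?thesis using assms(1) that by (simp add: eval_product sat_def)
  qed
  then show "eval (product I F) v s = eval (product I F) v t"
    by (rule PiE_ext[OF in_carr in_carr])
qed

lemma sat_HSP:
  assumes A: "A \<in> HSP K" and cl: "\<forall>M\<in>K. closed_under_ops M (carr M)"
    and sat: "\<forall>M\<in>K. sat M s t"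
  shows "sat A s t"
  using A
proof (rule HSP_E)
  fix I F S g
  assume F: "\<forall>i\<in>I. F i \<in> K" and S: "subuniverse S (product I F)"
    and g: "g \<in> hom ((product I F)\<lparr>carr := S\<rparr>) A" "g ` S = carr A"
  have "sat (product I F) s t" by (rule sat_product) (use F cl sat in blast)+
  then have "sat ((product I F)\<lparr>carr := S\<rparr>) s t"
    using S unfolding sat_def eval_carr_update subuniverse_def by simp (meson order_trans)
  then show ?thesis
    by (intro sat_hom_image[OF g(1)])
      (use g(2) S in \<open>simp_all add: subuniverse_def closed_under_ops_def\<close>)
qed

text \<open>\<open>theory_of\<close> records only identities in variables from \<open>nat\<close>.
  An identity contains finitely many variables, so renaming them injectively to naturals extends the
  inclusion of theories to any variable type.\<close>

lemma sat_via_nat_variables: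
  fixes s t :: "'v bterm" and A :: "'b bframe" and K :: "'a bframe set"
  assumes th: "theory_of K \<subseteq> theory_of {A}" and A: "closed_under_ops A (carr A)"
    and sat: "\<forall>M\<in>K. sat M s t"
  shows "sat A s t"
  unfolding sat_def
proof (intro allI impI)
  fix v :: "'v \<Rightarrow> 'b" assume v: "range v \<subseteq> carr A"
  let ?V = "set_bterm s \<union> set_bterm t"
  have "finite ?V" by (simp add: finite_set_bterm)
  from finite_imp_inj_to_nat_seg[OF this]
  obtain r :: "'v \<Rightarrow> nat" where r: "inj_on r ?V" by blast
  have "sat M (map_bterm r s) (map_bterm r t)" if "M \<in> K" for M
  proof -
    have "eval M (w \<circ> r) s = eval M (w \<circ> r) t" if "range w \<subseteq> carr M" for w
    proof -
      have "range (w \<circ> r) \<subseteq> carr M" using that by auto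
      then show ?thesis using sat \<open>M \<in> K\<close> unfolding sat_def by blast
    qed
    then show ?thesis unfolding sat_def eval_map by blast
  qed
  then have satA: "sat A (map_bterm r s) (map_bterm r t)"
    using th unfolding theory_of_def by auto
  \<comment> \<open>\<open>w\<close> undoes the renaming; naturals that name no variable get
    \<open>zero A\<close>, which keeps \<open>w\<close> inside the carrier.\<close>
  define w where "w n = (if n \<in> r ` ?V then v (inv_into ?V r n) else zero A)" for n
  have "range w \<subseteq> carr A"
    using v A by (simp add: image_subset_iff w_def closed_under_ops_def)
  then have "eval A (w \<circ> r) s = eval A (w \<circ> r) t"
    using satA unfolding sat_def eval_map by blast
  moreover have "(w \<circ> r) x = v x" if "x \<in> ?V" for x
    using that inv_into_f_f[OF r that] by (auto simp: w_def)
  then have "eval A (w \<circ> r) s = eval A v s" "eval A (w \<circ> r) t = eval A v t"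
    by (auto intro!: eval_cong)
  ultimately show "eval A v s = eval A v t" by simp
qed

text \<open>Completeness half of Birkhoff's theorem: \<open>A\<close> is a quotient of a
  \<open>K\<close>-free algebra, realised as the algebra \<open>range \<phi>\<close> of term values
  in a product with one factor for each non-identity of \<open>K\<close>.\<close>

theorem HSP_if_theory_of_subset:
  fixes A :: "'u bframe" and K :: "'a bframe set"
  assumes inf: "infinite (UNIV :: 'u set)"
    and K: "\<forall>M\<in>K. closed_under_ops M (carr M)"
    and A: "closed_under_ops A (carr A)"
    and th: "theory_of K \<subseteq> theory_of {A}"
  shows "A \<in> HSP K"
proof -
  obtain e :: "'u bterm \<times> 'u bterm \<Rightarrow> 'u" where e: "inj e"
    using infinite_inj_bterm_pairs[OF inf] ..
  \<comment> \<open>The terms use the elements of \<open>'u\<close> as variables. Each pair in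
    \<open>D\<close> gets a member \<open>M0\<close> of \<open>K\<close> and a valuation
    \<open>v0\<close> refuting it.\<close>
  define D where "D = {(s :: 'u bterm, t). \<not> (\<forall>M\<in>K. sat M s t)}"
  have "\<forall>p\<in>D. \<exists>M v. M \<in> K \<and> range v \<subseteq> carr M \<and> eval M v (fst p) \<noteq> eval M v (snd p)"
    unfolding D_def sat_def by auto
  then obtain M0 v0 where Mv0: "\<And>p. p \<in> D \<Longrightarrow> M0 p \<in> K \<and> range (v0 p) \<subseteq> carr (M0 p) \<and>
      eval (M0 p) (v0 p) (fst p) \<noteq> eval (M0 p) (v0 p) (snd p)"
    by metis
  define I where "I = e ` D"
  define M where "M i = M0 (inv e i)" for i
  define v where "v i = v0 (inv e i)" for i
  have M: "M i \<in> K" and v: "range (v i) \<subseteq> carr (M i)" if i: "i \<in> I" for i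
  proof -
    obtain p where p: "p \<in> D" "i = e p" using i unfolding I_def by blast
    then show "M i \<in> K" "range (v i) \<subseteq> carr (M i)"
      using Mv0[OF p(1)] inv_f_f[OF e] by (simp_all add: M_def v_def)
  qed
  have clM: "\<forall>i\<in>I. closed_under_ops (M i) (carr (M i))" using M K by blast
  let ?P = "product I M"
  \<comment> \<open>The free generators: coordinate \<open>i\<close> of \<open>x u\<close> is the
    value of the variable \<open>u\<close> under the refuting valuation with code
    \<open>i\<close>.\<close>
  define x where "x u = (\<lambda>i\<in>I. v i u)" for u
  define \<phi> where "\<phi> t = eval ?P x t" for t
  have x: "range x \<subseteq> carr ?P"
    using v by (fastforce simp: x_def product_def PiE_iff)
  have \<phi>_in: "\<phi> t \<in> carr ?P" for t
    unfolding \<phi>_def by (rule eval_in[OF closed_product[OF clM] x])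
  have sub: "subuniverse (range \<phi>) ?P"
    unfolding subuniverse_def closed_under_ops_def
  proof (intro conjI ballI)
    show "range \<phi> \<subseteq> carr ?P" using \<phi>_in by auto
    show "zero ?P \<in> range \<phi>" by (rule range_eqI[of _ _ Bot]) (simp add: \<phi>_def)
    fix y assume "y \<in> range \<phi>"
    then obtain s where s: "y = \<phi> s" by auto
    show "neg ?P y \<in> range \<phi>" by (rule range_eqI[of _ _ "Neg s"]) (simp add: \<phi>_def s)
    show "fop ?P y \<in> range \<phi>" by (rule range_eqI[of _ _ "Fop s"]) (simp add: \<phi>_def s)
    fix z assume "z \<in> range \<phi>"
    then obtain t where t: "z = \<phi> t" by auto
    show "meet ?P y z \<in> range \<phi>" by (rule range_eqI[of _ _ "Meet s t"]) (simp add: \<phi>_def s t)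
  qed
  \<comment> \<open>Each element of \<open>A\<close> names itself, so that \<open>g\<close> below is
    onto; the elements of \<open>'u\<close> outside \<open>A\<close> are sent to zero.\<close>
  define a where "a u = (if u \<in> carr A then u else zero A)" for u
  have a: "range a \<subseteq> carr A" using A by (auto simp: a_def closed_under_ops_def)
  have \<phi>_eq: "eval A a s = eval A a t" if "\<phi> s = \<phi> t" for s t
  proof -
    have "(s, t) \<notin> D"
    proof
      assume st: "(s, t) \<in> D"
      \<comment> \<open>If \<open>K\<close> refuted the identity, coordinate \<open>e (s, t)\<close>
        would separate \<open>\<phi> s\<close> from \<open>\<phi> t\<close>.\<close>
      define i where "i = e (s, t)"
      have i: "i \<in> I" "inv e i = (s, t)" using st inv_f_f[OF e] by (auto simp: i_def I_def)
      have "eval (M i) (v i) u = \<phi> u i" for u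
        using i(1) by (simp add: \<phi>_def eval_product x_def)
      then show False using Mv0[OF st] that by (simp add: M_def v_def i)
    qed
    then have "sat A s t" using sat_via_nat_variables[OF th A] by (auto simp: D_def)
    then show ?thesis using a by (auto simp: sat_def)
  qed
  \<comment> \<open>\<open>\<phi>_eq\<close> makes the chosen term immaterial, so \<open>g\<close>
    is well defined on \<open>range \<phi>\<close>.\<close>
  define g where "g y = eval A a (SOME t. y = \<phi> t)" for y
  have g: "g (\<phi> t) = eval A a t" for t
    unfolding g_def by (rule \<phi>_eq, rule sym, rule someI, rule refl)
  have \<phi>_simps: "zero ?P = \<phi> Bot" "meet ?P (\<phi> s) (\<phi> t) = \<phi> (Meet s t)"
    "neg ?P (\<phi> s) = \<phi> (Neg s)" "fop ?P (\<phi> s) = \<phi> (Fop s)" for s t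
    by (simp_all add: \<phi>_def)
  have "g \<in> hom (?P\<lparr>carr := range \<phi>\<rparr>) A"
    unfolding hom_def using eval_in[OF A a] by (auto simp: \<phi>_simps g)
  moreover have "g ` range \<phi> = carr A"
  proof
    show "g ` range \<phi> \<subseteq> carr A" using eval_in[OF A a] by (auto simp: g)
    show "carr A \<subseteq> g ` range \<phi>"
    proof
      fix y assume "y \<in> carr A"
      then have "g (\<phi> (Var y)) = y" by (simp add: g a_def)
      then show "y \<in> g ` range \<phi>" by (metis image_eqI rangeI)
    qed
  qed
  moreover have "?P\<lparr>carr := range \<phi>\<rparr> \<in> Scl (Pcl K)"
    unfolding Scl_def Pcl_def using sub M by blast
  ultimately show ?thesis
    unfolding HSP_def Hcl_def
    by (intro CollectI bexI[of _ "?P\<lparr>carr := range \<phi>\<rparr>"] bexI[of _ g]) simp_all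
qed

section \<open>Varieties and their equational theories\<close>

lemma theory_of_HSP:
  assumes "\<forall>M\<in>K. closed_under_ops M (carr M)"
  shows "theory_of K \<subseteq> theory_of (HSP K)"
  unfolding theory_of_def using sat_HSP[OF _ assms] by auto

lemma theory_of_mem: "A \<in> K \<Longrightarrow> theory_of K \<subseteq> theory_of {A}"
  unfolding theory_of_def by auto

lemma boolean_frame_closed: "boolean_frame A \<Longrightarrow> closed_under_ops A (carr A)"
  by (simp add: boolean_frame_def)

lemma sat_three_variables:
  assumes "sat A s t" "x \<in> carr A" "y \<in> carr A" "z \<in> carr A"
  shows "eval A ((\<lambda>_. z)(0 := x, Suc 0 := y)) s = eval A ((\<lambda>_. z)(0 := x, Suc 0 := y)) t"
proof -
  have "range ((\<lambda>_ :: nat. z)(0 := x, Suc 0 := y)) \<subseteq> carr A" using assms(2-4) by auto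
  then show ?thesis using assms(1) unfolding sat_def by blast
qed

text \<open>Apart from closure of the carrier, all the axioms are identities in at most three
  variables, which \<open>A\<close> inherits from \<open>K\<close>.\<close>

lemma boolean_frame_HSP:
  assumes A: "A \<in> HSP K" and K: "\<forall>M\<in>K. boolean_frame M"
  shows "boolean_frame A"
proof -
  let ?x = "Var 0 :: nat bterm" and ?y = "Var (Suc 0) :: nat bterm"
    and ?z = "Var (Suc (Suc 0)) :: nat bterm"
  let ?J = "\<lambda>s t :: nat bterm. Neg (Meet (Neg s) (Neg t))"
  have K': "\<forall>M\<in>K. closed_under_ops M (carr M)" using K boolean_frame_closed by blast
  have sat: "sat A s t" if "\<And>M. M \<in> K \<Longrightarrow> sat M s t" for s t :: "nat bterm"
    using sat_HSP[OF A K'] that by blast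
  have m_comm: "sat A (Meet ?x ?y) (Meet ?y ?x)"
    and j_comm: "sat A (?J ?x ?y) (?J ?y ?x)"
    and m_assoc: "sat A (Meet (Meet ?x ?y) ?z) (Meet ?x (Meet ?y ?z))"
    and j_assoc: "sat A (?J (?J ?x ?y) ?z) (?J ?x (?J ?y ?z))"
    and m_distr: "sat A (Meet ?x (?J ?y ?z)) (?J (Meet ?x ?y) (Meet ?x ?z))"
    and j_distr: "sat A (?J ?x (Meet ?y ?z)) (Meet (?J ?x ?y) (?J ?x ?z))"
    and m_one: "sat A (Meet ?x (Neg Bot)) ?x"
    and j_zero: "sat A (?J ?x Bot) ?x"
    and m_neg: "sat A (Meet ?x (Neg ?x)) Bot"
    and j_neg: "sat A (?J ?x (Neg ?x)) (Neg Bot)"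
    using K
    by (intro sat; force simp: sat_def boolean_frame_def join_def one_def image_subset_iff)+
  note axioms = m_comm j_comm m_assoc j_assoc m_distr j_distr m_one j_zero m_neg j_neg
  show ?thesis
    unfolding boolean_frame_def join_def one_def
    by (intro conjI ballI closed_HSP[OF A];
        rule axioms[THEN sat_three_variables, simplified]; assumption)
qed

lemma contractive_HSP:
  assumes A: "A \<in> HSP K" and K: "\<forall>M\<in>K. closed_under_ops M (carr M)"
    and contr: "\<forall>M\<in>K. contractive M"
  shows "contractive A"
proof -
  let ?x = "Var 0 :: nat bterm"
  have "sat A (Meet (Fop ?x) ?x) (Fop ?x)"
    using contr
    by (intro sat_HSP[OF A K]) (force simp: sat_def contractive_def le_def image_subset_iff)
  from sat_three_variables[OF this] show ?thesis
    by (simp add: contractive_def le_def)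
qed

text \<open>Closure under \<open>HSP\<close> is read off the theories: identities of
  \<open>K\<close> survive two applications of \<open>HSP\<close>, and completeness then returns to
  a single one.\<close>

lemma variety_HSP:
  fixes K :: "'a bframe set"
  assumes inf: "infinite (UNIV :: 'u set)" and K: "\<forall>M\<in>K. boolean_frame M"
  shows "variety (HSP K :: 'u bframe set)"
  unfolding variety_def
proof
  have clK: "\<forall>M\<in>K. closed_under_ops M (carr M)" using K boolean_frame_closed by blast
  show "\<forall>A\<in>(HSP K :: 'u bframe set). boolean_frame A" using boolean_frame_HSP K by blast
  show "HSP (HSP K :: 'u bframe set) \<subseteq> (HSP K :: 'u bframe set)"
  proof
    fix A :: "'u bframe" assume A: "A \<in> HSP (HSP K :: 'u bframe set)"
    have "theory_of K \<subseteq> theory_of (HSP K :: 'u bframe set)" by (rule theory_of_HSP[OF clK])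
    also have "\<dots> \<subseteq> theory_of (HSP (HSP K :: 'u bframe set) :: 'u bframe set)"
      by (rule theory_of_HSP) (use closed_HSP in blast)
    also have "\<dots> \<subseteq> theory_of {A}" by (rule theory_of_mem[OF A])
    finally show "A \<in> HSP K" by (rule HSP_if_theory_of_subset[OF inf clK closed_HSP[OF A]])
  qed
qed

lemma variety_subset_if_theory_of_subset:
  fixes V W :: "'u bframe set"
  assumes inf: "infinite (UNIV :: 'u set)" and "variety V" "variety W"
    and th: "theory_of W \<subseteq> theory_of V"
  shows "V \<subseteq> W"
proof
  fix A assume A: "A \<in> V"
  have "theory_of W \<subseteq> theory_of {A}" using th theory_of_mem[OF A] by blast
  then have "A \<in> HSP W"
    using HSP_if_theory_of_subset[OF inf] assms(2,3) A boolean_frame_closed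
    unfolding variety_def by blast
  then show "A \<in> W" using assms(3) unfolding variety_def by blast
qed

text \<open>A variety is determined by its theory, and coding pairs of terms by naturals turns
  theories into subsets of \<open>nat\<close>.\<close>

lemma varieties_lepoll_continuum:
  assumes inf: "infinite (UNIV :: 'u set)"
  shows "{V :: 'u bframe set. variety V} \<lesssim> (UNIV :: nat set set)"
proof -
  obtain e :: "nat bterm \<times> nat bterm \<Rightarrow> nat" where e: "inj e"
    using infinite_inj_bterm_pairs[OF infinite_UNIV_nat] ..
  have "inj_on (\<lambda>V :: 'u bframe set. e ` theory_of V) {V. variety V}"
  proof (rule inj_onI)
    fix V W :: "'u bframe set"
    assume VW: "V \<in> {V. variety V}" "W \<in> {V. variety V}" and "e ` theory_of V = e ` theory_of W"
    then have "theory_of V = theory_of W" using inj_image_eq_iff[OF e] by blast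
    with VW show "V = W" using variety_subset_if_theory_of_subset[OF inf] by blast
  qed
  then show ?thesis unfolding lepoll_def by blast
qed

section \<open>Isomorphic copies\<close>

text \<open>Transport of structure along \<open>j\<close>. The frames \<open>\<BB> X\<close> live on
  \<open>nat set\<close>, while the members of \<open>HSP\<close> considered here must live on
  \<open>'u\<close>.\<close>

definition copy :: "('a \<Rightarrow> 'b) \<Rightarrow> 'a bframe \<Rightarrow> 'b bframe" where
  "copy j A = \<lparr> carr = j ` carr A,
     meet = (\<lambda>x y. j (meet A (inv_into (carr A) j x) (inv_into (carr A) j y))),
     neg = (\<lambda>x. j (neg A (inv_into (carr A) j x))),
     zero = j (zero A),
     fop = (\<lambda>x. j (fop A (inv_into (carr A) j x))) \<rparr>"

lemma copy_hom: "inj_on j (carr A) \<Longrightarrow> j \<in> hom A (copy j A)"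
  by (auto simp: hom_def copy_def)

lemma copy_inv_hom:
  assumes "inj_on j (carr A)" "closed_under_ops A (carr A)"
  shows "inv_into (carr A) j \<in> hom (copy j A) A"
  using assms by (auto simp: hom_def copy_def closed_under_ops_def)

lemma carr_copy: "carr (copy j A) = j ` carr A"
  by (simp add: copy_def)

lemma closed_copy:
  assumes "inj_on j (carr A)" "closed_under_ops A (carr A)"
  shows "closed_under_ops (copy j A) (carr (copy j A))"
  using closed_hom_image[OF copy_hom[OF assms(1)] carr_copy[symmetric] assms(2)] .

lemma sat_copy_iff:
  assumes j: "inj_on j (carr A)" and cl: "closed_under_ops A (carr A)"
  shows "sat (copy j A) s t \<longleftrightarrow> sat A s t"
proof
  assume "sat A s t"
  then show "sat (copy j A) s t"
    using sat_hom_image[OF copy_hom[OF j]] cl carr_copy by metis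
next
  assume "sat (copy j A) s t"
  moreover have "inv_into (carr A) j ` carr (copy j A) = carr A"
    using j by (simp add: carr_copy)
  ultimately show "sat A s t"
    using sat_hom_image[OF copy_inv_hom[OF j cl]] closed_copy[OF j cl] by blast
qed

lemma copy_in_HSP:
  fixes j :: "'a \<Rightarrow> 'u"
  assumes "infinite (UNIV :: 'u set)" "inj_on j (carr A)" "closed_under_ops A (carr A)"
  shows "copy j A \<in> HSP {A}"
  by (rule HSP_if_theory_of_subset)
    (use assms closed_copy[OF assms(2,3)] in
      \<open>auto simp: theory_of_def sat_copy_iff[OF assms(2,3)]\<close>)

lemma congruence_vimage:
  assumes g: "g \<in> hom A B" and cl: "closed_under_ops A (carr A)" and \<Psi>: "congruence B \<Psi>"
  shows "congruence A {(x, y). x \<in> carr A \<and> y \<in> carr A \<and> (g x, g y) \<in> \<Psi>}"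
proof -
  have eq: "equiv (carr B) \<Psi>" using \<Psi> by (simp add: congruence_def)
  have "equiv (carr A) {(x, y). x \<in> carr A \<and> y \<in> carr A \<and> (g x, g y) \<in> \<Psi>}"
  proof (rule equivI)
    show "refl_on (carr A) {(x, y). x \<in> carr A \<and> y \<in> carr A \<and> (g x, g y) \<in> \<Psi>}"
      using eq g by (auto simp: refl_on_def equiv_def hom_def)
    show "sym {(x, y). x \<in> carr A \<and> y \<in> carr A \<and> (g x, g y) \<in> \<Psi>}"
      using eq by (auto simp: equiv_def sym_def)
    show "trans {(x, y). x \<in> carr A \<and> y \<in> carr A \<and> (g x, g y) \<in> \<Psi>}"
      using eq unfolding equiv_def trans_def by blast
  qed auto
  then show ?thesis
    using g cl \<Psi> by (auto simp: congruence_def hom_def closed_under_ops_def)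
qed

lemma CEP_copyD:
  assumes j: "inj_on j (carr A)" and cl: "closed_under_ops A (carr A)" and CEP: "CEP (copy j A)"
  shows "CEP A"
  unfolding CEP_def
proof (intro allI impI)
  fix B \<Theta>
  assume B: "subuniverse B A" and \<Theta>: "congruence (A\<lparr>carr := B\<rparr>) \<Theta>"
  have BA: "B \<subseteq> carr A" and clB: "closed_under_ops A B" using B by (auto simp: subuniverse_def)
  have \<Theta>B: "\<Theta> \<subseteq> B \<times> B" using \<Theta> by (auto simp: congruence_def equiv_def)
  let ?i = "inv_into (carr A) j"
  have i: "?i (j x) = x" if "x \<in> B" for x using that BA j by (auto simp: subset_iff)
  have subB: "subuniverse (j ` B) (copy j A)"
    using BA clB by (auto simp: subuniverse_def closed_under_ops_def copy_def i)
  have "?i \<in> hom ((copy j A)\<lparr>carr := j ` B\<rparr>) (A\<lparr>carr := B\<rparr>)"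
    using cl clB BA j by (auto simp: hom_def copy_def closed_under_ops_def i subset_iff)
  from congruence_vimage[OF this _ \<Theta>]
  have "congruence ((copy j A)\<lparr>carr := j ` B\<rparr>)
      {(x, y). x \<in> j ` B \<and> y \<in> j ` B \<and> (?i x, ?i y) \<in> \<Theta>}"
    using subB by (simp add: subuniverse_def closed_under_ops_def)
  then obtain \<Psi> where \<Psi>: "congruence (copy j A) \<Psi>"
    and ext: "\<Psi> \<inter> (j ` B \<times> j ` B) = {(x, y). x \<in> j ` B \<and> y \<in> j ` B \<and> (?i x, ?i y) \<in> \<Theta>}"
    using CEP subB unfolding CEP_def by meson
  have "(j x, j y) \<in> \<Psi> \<longleftrightarrow> (x, y) \<in> \<Theta>" if "x \<in> B" "y \<in> B" for x y
  proof -
    have "(j x, j y) \<in> \<Psi> \<longleftrightarrow> (j x, j y) \<in> \<Psi> \<inter> (j ` B \<times> j ` B)" using that by blast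
    also have "\<dots> \<longleftrightarrow> (x, y) \<in> \<Theta>" unfolding ext using that by (simp add: i)
    finally show ?thesis .
  qed
  then have "{(x, y). x \<in> carr A \<and> y \<in> carr A \<and> (j x, j y) \<in> \<Psi>} \<inter> (B \<times> B) = \<Theta>"
    using BA \<Theta>B by auto
  with congruence_vimage[OF copy_hom[OF j] cl \<Psi>]
  show "\<exists>\<Psi>. congruence A \<Psi> \<and> \<Psi> \<inter> (B \<times> B) = \<Theta>" by blast
qed

section \<open>The frames \<open>\<BB> X\<close>\<close>

lemma mem_E_iff: "x \<in> E \<longleftrightarrow> even x"
  by (auto simp: E_def)

lemma mem_twoE_iff: "x \<in> twoE \<longleftrightarrow> 4 dvd x"
  by (auto simp: twoE_def E_def dvd_def)

lemma infinite_residue_class: "m > 0 \<Longrightarrow> infinite (range (\<lambda>n. m * n + k :: nat))"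
  by (rule range_inj_infinite) (auto intro: injI)

section \<open>Constant terms in \<open>\<BB> X\<close>\<close>

lemma h_iterate_UNIV: "(h X ^^ n) UNIV = UNIV - {..<n}"
proof (induction n)
  case (Suc n)
  then show ?case by (simp add: h_final_segment lessThan_Suc_atMost)
qed simp

lemma h_initial_segment: "h X {..n} = (if n \<in> X then {} else {..n})"
proof -
  have "{..n} \<noteq> UNIV - {..<m}" for m
    by (metis Diff_infinite_finite finite_atMost finite_lessThan infinite_UNIV_nat)
  moreover have "{..n} \<noteq> UNIV - twoE"
  proof
    assume "{..n} = UNIV - twoE"
    \<comment> \<open>\<open>4 * n + 1\<close> is not a multiple of 4, hence lies in the complement
      of \<open>twoE\<close>, but it exceeds \<open>n\<close>.\<close>
    then have "4 * n + 1 \<in> {..n}" by (simp add: mem_twoE_iff) presburger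
    then show False by simp
  qed
  ultimately show ?thesis by (auto simp: h_def)
qed

text \<open>\<open>n\<close> iterations of \<open>h\<close> on the top element remove the numbers
  below \<open>n\<close>, so \<open>Suc n\<close> of them are required for the complement to be
  \<open>{..n}\<close>.\<close>

definition separator :: "nat \<Rightarrow> nat bterm" where
  "separator n = Fop (Neg ((Fop ^^ Suc n) (Neg Bot)))"

lemma sat_separator_iff: "sat (\<BB> X) (separator n) Bot \<longleftrightarrow> n \<in> X"
proof -
  have iter: "eval (\<BB> X) v ((Fop ^^ k) (Neg Bot)) = (h X ^^ k) UNIV" for v k
    by (induction k) (auto simp: \<BB>_def)
  have "eval (\<BB> X) v (separator n) = h X (- (h X ^^ Suc n) UNIV)" for v
    unfolding separator_def using iter[of v "Suc n"] by (simp add: \<BB>_def)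
  also have "\<dots> = h X {..n}"
    unfolding h_iterate_UNIV by (simp add: Compl_eq_Diff_UNIV[symmetric] lessThan_Suc_atMost)
  finally show ?thesis
    by (auto simp: sat_def h_initial_segment) (auto simp: \<BB>_def)
qed

text \<open>A final segment loses one point, and an initial segment that is sent to the empty set is
  finite. Only at \<open>- twoE\<close> does \<open>h\<close> remove infinitely many points.\<close>

lemma h_almost_eq:
  assumes "S \<noteq> - twoE"
  shows "finite (sym_diff S (h X S))"
proof -
  consider n where "S = UNIV - {..<n}" | "h X S = S" | "finite S" "h X S = {}"
  proof (cases "\<exists>n. S = UNIV - {..<n}")
    case False
    then have "h X S = S \<or> finite S \<and> h X S = {}"
      using assms by (auto simp: h_def Compl_eq_Diff_UNIV)
    then show ?thesis using that by blast
  qed (use that in blast)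
  then show ?thesis
  proof cases
    case (1 n)
    have "sym_diff S (h X S) \<subseteq> {..n}" unfolding 1 h_final_segment by auto
    then show ?thesis using finite_subset by blast
  qed auto
qed

section \<open>A congruence of a subalgebra that does not extend\<close>

lemma not_CEP_\<BB>: "\<not> CEP (\<BB> X)"
proof
  assume CEP: "CEP (\<BB> X)"
  \<comment> \<open>Agreement up to finitely many elements with one of the four sets means: the
    trace on \<open>E\<close> and the trace on \<open>- E\<close> are each finite or cofinite
    there.\<close>
  define B where "B = {S. (finite (S \<inter> E) \<or> finite (E - S)) \<and> (finite (S - E) \<or> finite (- E - S))}"
  define \<Theta> where "\<Theta> = {(S, T). S \<in> B \<and> T \<in> B \<and> finite (sym_diff S T)}"
  have B_almost: "T \<in> B" if S: "S \<in> B" and fin: "finite (sym_diff S T)" for S T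
  proof -
    have "finite (S \<inter> E) \<Longrightarrow> finite (T \<inter> E)" "finite (E - S) \<Longrightarrow> finite (E - T)"
      "finite (S - E) \<Longrightarrow> finite (T - E)" "finite (- E - S) \<Longrightarrow> finite (- E - T)"
      by (rule finite_subset[OF _ finite_UnI[OF _ fin]]; blast)+
    then show ?thesis using S by (auto simp: B_def)
  qed
  \<comment> \<open>\<open>twoE\<close> cuts \<open>E\<close> into two infinite pieces, the residues
    0 and 2 modulo 4. So \<open>h\<close> moves each member of \<open>B\<close> only by a finite
    set.\<close>
  have "- twoE \<notin> B"
  proof -
    have "range (\<lambda>n. 4 * n + 2) \<subseteq> - twoE \<inter> E" "range (\<lambda>n. 4 * n + 0) \<subseteq> E - - twoE"
      by (auto simp: mem_E_iff mem_twoE_iff) presburger+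
    then have "infinite (- twoE \<inter> E)" "infinite (E - - twoE)"
      using infinite_residue_class[of 4] by (meson infinite_super zero_less_numeral)+
    then show ?thesis by (simp add: B_def)
  qed
  then have hB: "finite (sym_diff S (h X S))" if "S \<in> B" for S
    using that h_almost_eq by metis
  have Int_B: "S \<inter> T \<in> B" if "S \<in> B" "T \<in> B" for S T
  proof -
    have "finite (S \<inter> E) \<or> finite (T \<inter> E) \<Longrightarrow> finite (S \<inter> T \<inter> E)"
      "finite (S - E) \<or> finite (T - E) \<Longrightarrow> finite (S \<inter> T - E)"
      by (erule disjE; erule finite_subset[rotated]; blast)+
    then show ?thesis using that by (auto simp: B_def Diff_Int)
  qed
  have Compl_B: "- S \<in> B" if "S \<in> B" for S
    using that by (auto simp: B_def Diff_eq Int_commute)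
  have h_B: "h X S \<in> B" if "S \<in> B" for S
    using B_almost[OF that hB[OF that]] .
  have "{} \<in> B" by (simp add: B_def)
  then have sub: "subuniverse B (\<BB> X)"
    by (simp add: subuniverse_def closed_under_ops_def \<BB>_def Int_B Compl_B h_B)
  have \<Theta>_trans: "finite (sym_diff S U)"
    if "finite (sym_diff S T)" "finite (sym_diff T U)" for S T U :: "nat set"
    by (rule finite_subset[OF _ finite_UnI[OF that]]) blast
  have \<Theta>_sym: "finite (sym_diff T S)" if "finite (sym_diff S T)" for S T :: "nat set"
    using that by (simp add: Un_commute)
  have "congruence ((\<BB> X)\<lparr>carr := B\<rparr>) \<Theta>"
    unfolding congruence_def
  proof (intro conjI allI impI)
    have "refl_on B \<Theta>" "sym \<Theta>" by (auto simp: refl_on_def sym_def \<Theta>_def)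
    moreover have "trans \<Theta>"
      using \<Theta>_trans unfolding trans_def \<Theta>_def mem_Collect_eq case_prod_conv by blast
    moreover have "\<Theta> \<subseteq> B \<times> B" by (auto simp: \<Theta>_def)
    ultimately show "equiv (carr ((\<BB> X)\<lparr>carr := B\<rparr>)) \<Theta>" by (simp add: equivI)
  next
    fix S S' T T' assume "(S, S') \<in> \<Theta>" "(T, T') \<in> \<Theta>"
    then have *: "S \<in> B" "S' \<in> B" "T \<in> B" "T' \<in> B" "finite (sym_diff S S')" "finite (sym_diff T T')"
      by (auto simp: \<Theta>_def)
    have "finite (sym_diff (S \<inter> T) (S' \<inter> T'))"
      by (rule finite_subset[OF _ finite_UnI[OF *(5,6)]]) blast
    then show "(meet ((\<BB> X)\<lparr>carr := B\<rparr>) S T, meet ((\<BB> X)\<lparr>carr := B\<rparr>) S' T') \<in> \<Theta>"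
      using * Int_B by (simp add: \<Theta>_def \<BB>_def)
  next
    fix S S' assume "(S, S') \<in> \<Theta>"
    then have *: "S \<in> B" "S' \<in> B" "finite (sym_diff S S')"
      by (auto simp: \<Theta>_def)
    have "finite (sym_diff (- S) (- S'))"
      by (rule finite_subset[OF _ *(3)]) blast
    then show "(neg ((\<BB> X)\<lparr>carr := B\<rparr>) S, neg ((\<BB> X)\<lparr>carr := B\<rparr>) S') \<in> \<Theta>"
      using * Compl_B by (simp add: \<Theta>_def \<BB>_def)
    \<comment> \<open>Chain of finite differences: from \<open>h X S\<close> to \<open>S\<close>, to
      \<open>S'\<close>, to \<open>h X S'\<close>.\<close>
    have "finite (sym_diff (h X S) (h X S'))"
      using \<Theta>_trans \<Theta>_sym hB * by meson
    then show "(fop ((\<BB> X)\<lparr>carr := B\<rparr>) S, fop ((\<BB> X)\<lparr>carr := B\<rparr>) S') \<in> \<Theta>"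
      using * h_B by (simp add: \<Theta>_def \<BB>_def)
  qed
  then obtain \<Psi> where \<Psi>: "congruence (\<BB> X) \<Psi>" and ext: "\<Psi> \<inter> (B \<times> B) = \<Theta>"
    using CEP sub unfolding CEP_def by meson
  have refl: "(S, S) \<in> \<Psi>" for S
    using \<Psi> by (simp add: congruence_def equiv_def refl_on_def \<BB>_def)
  have \<Psi>_meet: "(S \<inter> T, S' \<inter> T') \<in> \<Psi>" if "(S, S') \<in> \<Psi>" "(T, T') \<in> \<Psi>" for S S' T T'
    using \<Psi> that by (simp add: congruence_def \<BB>_def)
  have \<Psi>_neg: "(- S, - S') \<in> \<Psi>" and \<Psi>_h: "(h X S, h X S') \<in> \<Psi>" if "(S, S') \<in> \<Psi>" for S S'
    using \<Psi> that by (simp_all add: congruence_def \<BB>_def)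
  have "UNIV \<in> B" by (simp add: B_def)
  then have "(UNIV, UNIV - {0}) \<in> \<Theta>"
    using B_almost[of UNIV "UNIV - {0}"] by (simp add: \<Theta>_def double_diff)
  then have "(UNIV, UNIV - {0}) \<in> \<Psi>" using ext by blast
  \<comment> \<open>Meeting with \<open>twoE\<close> and complementing leads out of
    \<open>B\<close>, to two sets that differ only in the point 0 but whose images under
    \<open>h\<close> differ infinitely.\<close>
  from \<Psi>_neg[OF \<Psi>_meet[OF this refl[of twoE]]]
  have "(- twoE, - ((UNIV - {0}) \<inter> twoE)) \<in> \<Psi>" by simp
  moreover define S where "S = - ((UNIV - {0}) \<inter> twoE)"
  ultimately have "(h X (- twoE), h X S) \<in> \<Psi>" using \<Psi>_h by simp
  moreover have "h X S = S"
  proof -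
    \<comment> \<open>Containing 0 but not 4 excludes final segments, containing 0 excludes
      \<open>- twoE\<close>, and containing 5 but not 4 excludes initial segments; so
      \<open>h\<close> fixes \<open>S\<close>.\<close>
    have mem: "0 \<in> S" "4 \<notin> S" "5 \<in> S" "0 \<in> twoE" by (auto simp: S_def mem_twoE_iff)
    have "S \<noteq> UNIV - {..<n}" for n
    proof
      assume "S = UNIV - {..<n}"
      then have "n = 0" "4 < n" using mem by auto
      then show False by simp
    qed
    moreover have "S \<noteq> UNIV - twoE" using mem by auto
    moreover have "S \<noteq> {..n}" for n using mem by auto
    ultimately show ?thesis by (simp add: h_def)
  qed
  ultimately have "({}, S) \<in> \<Psi>" using h_compl_twoE by (simp add: Compl_eq_Diff_UNIV)
  \<comment> \<open>\<open>S\<close> is not in \<open>B\<close>, but it contains every odd number;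
    meeting with \<open>- E\<close> returns to \<open>B\<close>, where \<open>\<Psi>\<close>
    restricts to \<open>\<Theta>\<close>.\<close>
  from \<Psi>_meet[OF this refl[of "- E"]]
  have "({}, S \<inter> - E) \<in> \<Psi>" by simp
  moreover have "S \<inter> - E = - E" by (auto simp: S_def mem_E_iff mem_twoE_iff) presburger
  ultimately have "({}, - E) \<in> \<Psi>" by simp
  moreover have "- E \<in> B" by (simp add: B_def)
  ultimately have "({}, - E) \<in> \<Theta>" using ext \<open>{} \<in> B\<close> by blast
  then have "finite (- E)" by (simp add: \<Theta>_def)
  moreover have "range (\<lambda>n. 2 * n + 1) \<subseteq> - E" by (auto simp: mem_E_iff)
  ultimately show False using infinite_residue_class[of 2 1] finite_subset by auto
qed

section \<open>Separating and counting the varieties\<close>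

theorem theorem2p5:
  assumes universe: "(UNIV :: nat set set) \<lesssim> (UNIV :: 'u set)"
  shows "(\<forall>X Y. X \<noteq> Y \<longrightarrow> (HSP {\<BB> X} :: 'u bframe set) \<noteq> HSP {\<BB> Y}) \<and>
         {V :: 'u bframe set. contractive_variety V \<and> lacks_CEP V} \<approx> (UNIV :: real set)"
proof -
  obtain j :: "nat set \<Rightarrow> 'u" where j: "inj j" using universe unfolding lepoll_def by blast
  have inf: "infinite (UNIV :: 'u set)"
    using j by (metis Finite_Set.finite_set finite_imageD infinite_UNIV_nat infinite_super top_greatest)
  have inj_carr: "inj_on j (carr (\<BB> X))" for X using j by (simp add: \<BB>_def)
  have cl: "closed_under_ops (\<BB> X) (carr (\<BB> X))" for X
    by (rule boolean_frame_closed[OF boolean_frame_\<BB>])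
  have copy_in: "copy j (\<BB> X) \<in> (HSP {\<BB> X} :: 'u bframe set)" for X
    by (rule copy_in_HSP[OF inf inj_carr cl])
  have subset: "X \<subseteq> Y" if "(HSP {\<BB> X} :: 'u bframe set) = HSP {\<BB> Y}" for X Y
  proof
    fix n assume "n \<in> X"
    \<comment> \<open>The identity coding \<open>n \<in> X\<close> holds throughout
      \<open>HSP {\<BB> X}\<close>, which by assumption contains the copy of
      \<open>\<BB> Y\<close>.\<close>
    then have "sat (copy j (\<BB> Y)) (separator n) Bot"
      using copy_in[of Y] that cl
      by (intro sat_HSP[of "copy j (\<BB> Y)" "{\<BB> X}"]) (simp_all add: sat_separator_iff)
    then show "n \<in> Y"
      by (simp add: sat_copy_iff[OF inj_carr cl] sat_separator_iff)
  qed
  then have distinct: "X = Y" if "(HSP {\<BB> X} :: 'u bframe set) = HSP {\<BB> Y}" for X Y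
    using that by (metis subset_antisym)
  have contr: "contractive_variety (HSP {\<BB> X} :: 'u bframe set)" for X
    using variety_HSP[OF inf, of "{\<BB> X}"] boolean_frame_\<BB> contractive_HSP[of _ "{\<BB> X}"]
      contractive_\<BB> cl
    by (auto simp: contractive_variety_def)
  have lacks: "lacks_CEP (HSP {\<BB> X} :: 'u bframe set)" for X
    using copy_in CEP_copyD[OF inj_carr cl] not_CEP_\<BB> unfolding lacks_CEP_def by blast
  let ?V = "{V :: 'u bframe set. contractive_variety V \<and> lacks_CEP V}"
  have "?V \<lesssim> {V :: 'u bframe set. variety V}"
    by (rule subset_imp_lepoll) (auto simp: contractive_variety_def)
  also have "\<dots> \<lesssim> (UNIV :: nat set set)" by (rule varieties_lepoll_continuum[OF inf])
  finally have upper: "?V \<lesssim> (UNIV :: nat set set)" .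
  have "inj (\<lambda>X. HSP {\<BB> X} :: 'u bframe set)" using distinct by (rule injI)
  then have lower: "(UNIV :: nat set set) \<lesssim> ?V"
    using contr lacks unfolding lepoll_def by blast
  \<comment> \<open>The bounds combine by Schroeder-Bernstein.\<close>
  have "?V \<approx> (UNIV :: real set)"
    using lepoll_antisym[OF upper lower] nat_sets_eqpoll_reals eqpoll_trans by blast
  then show ?thesis using distinct by blast
qed

end
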